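(* Let $q$ be a prime power of characteristic $p$ (that is, $p=\operatorname{char}(\mathbb{F}_q)$), and let $n$ be a positive integer. Write $n = p^k m$ with $k\ge 0$ and $\gcd(m,p)=1$. Then \[ h_q(n)=0 \quad\text{if and only if}\quad h_q(m)=0 . \]
   Context: For a positive integer $N$, the cyclic shift operator $\sigma$ on the $N$-dimensional space $\mathbb{F}_q^N$ over the finite field $\mathbb{F}_q$ is $\sigma(x_0,x_1,\ldots,x_{N-1})=(x_{N-1},x_0,\ldots,x_{N-2})$. An $\mathbb{F}_q$-linear subspace $U\subseteq\mathbb{F}_q^N$ is called cyclically covering if $\mathbb{F}_q^N=\bigcup_{i=0}^{N-1}\sigma^i(U)$. Define \[ h_q(N)=N-\min\{\dim U \mid U \text{ is a cyclically covering subspace of } \mathbb{F}_q^N\}. \] Thus $h_q(N)=0$ if and only if the only cyclically covering subspace of $\mathbb{F}_q^N$ is $\mathbb{F}_q^N$ itself. *)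

theory Defs
  imports "Jordan_Normal_Form.VS_Connect"
begin

definition cyclic_shift :: "'a vec \<Rightarrow> 'a vec" where
  "cyclic_shift x =
     vec (dim_vec x) (\<lambda>i. if i = 0 then x $ (dim_vec x - 1) else x $ (i - 1))"

definition cyclically_covering :: "nat \<Rightarrow> 'a::field vec set \<Rightarrow> bool" where
  "cyclically_covering N U \<longleftrightarrow>
     VectorSpace.subspace class_ring U (module_vec TYPE('a) N) \<and>
     carrier_vec N = (\<Union>i<N. (cyclic_shift ^^ i) ` U)"

definition subspace_dim :: "nat \<Rightarrow> 'a::field vec set \<Rightarrow> nat" where
  "subspace_dim N U = vectorspace.dim class_ring ((module_vec TYPE('a) N)\<lparr>carrier := U\<rparr>)"

text \<open>
  The field with \<open>q\<close> elements enters as a type of class \<open>{finite, field}\<close>, so the subscript of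
  \<open>h\<^sub>q\<close> becomes a type argument. For \<open>N > 0\<close> the whole space is
  cyclically covering, so the minimum is attained and is at most \<open>N\<close>; in particular the
  subtraction on \<open>nat\<close> does not truncate.
\<close>

definition cyc_h :: "'a::{finite,field} itself \<Rightarrow> nat \<Rightarrow> nat" where
  "cyc_h _ N = N - Min {subspace_dim N U | U :: 'a vec set. cyclically_covering N U}"

end

theory Submission
  imports Defs
begin

text \<open>
  \<open>h\<^sub>q(N) = 0\<close> means that every proper subspace of \<open>F\<^sup>N\<close> is escaped by the whole shift orbit of some
  vector. Summing over residues modulo \<open>m\<close> is a shift-equivariant surjection \<open>F\<^sup>n \<rightarrow> F\<^sup>m\<close>, so this
  property passes from \<open>n\<close> to \<open>m\<close>. For the converse, the operator \<open>D = \<sigma>\<^sup>m - 1\<close> on \<open>F\<^sup>n\<close> is nilpotent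
  in characteristic \<open>p\<close>. Given a proper subspace \<open>U\<close>, let \<open>j\<close> be such that \<open>W = {x. D\<^sup>j x \<in> U}\<close> is
  proper but \<open>{x. D\<^sup>j\<^sup>+\<^sup>1 x \<in> U}\<close> is not. Then \<open>W\<close> contains the image of \<open>D\<close>, and modulo this image
  padding by zeros \<open>F\<^sup>m \<rightarrow> F\<^sup>n\<close> is surjective and shift-equivariant. Hence \<open>W\<close> pulls back to a proper
  subspace of \<open>F\<^sup>m\<close>; if the orbit of \<open>y\<close> escapes it, the orbit of \<open>D\<^sup>j y\<close> escapes \<open>U\<close>.
\<close>

abbreviation vec_subspace :: "nat \<Rightarrow> 'a::field vec set \<Rightarrow> bool" where
  "vec_subspace n U \<equiv> VectorSpace.subspace class_ring U (module_vec TYPE('a) n)"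

definition vec_linear :: "nat \<Rightarrow> nat \<Rightarrow> ('a::field vec \<Rightarrow> 'a vec) \<Rightarrow> bool" where
  "vec_linear n m f \<longleftrightarrow> f \<in> carrier_vec n \<rightarrow> carrier_vec m \<and>
     (\<forall>x\<in>carrier_vec n. \<forall>y\<in>carrier_vec n. f (x + y) = f x + f y) \<and>
     (\<forall>c. \<forall>x\<in>carrier_vec n. f (c \<cdot>\<^sub>v x) = c \<cdot>\<^sub>v f x)"

text \<open>Letting \<open>i\<close> range over all naturals keeps the condition invariant under
  shifting. For \<open>n > 0\<close> it says the same as \<open>i < n\<close>, because the
  \<open>n\<close>-fold shift is the identity on vectors of length \<open>n\<close>.\<close>

definition escapes :: "nat \<Rightarrow> 'a::field vec set \<Rightarrow> bool" where
  "escapes n U \<longleftrightarrow> (\<exists>x\<in>carrier_vec n. \<forall>i. (cyclic_shift ^^ i) x \<notin> U)"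

text \<open>If a vector of length \<open>n\<close> is read as an element of F[X]/(X^n - 1), the
  shift is multiplication by X and this operator is multiplication by X^m - 1.\<close>

definition shift_diff :: "nat \<Rightarrow> 'a::field vec \<Rightarrow> 'a vec" where
  "shift_diff m x = (cyclic_shift ^^ m) x - x"

definition pad :: "nat \<Rightarrow> nat \<Rightarrow> 'a::field vec \<Rightarrow> 'a vec" where
  "pad n m y = vec n (\<lambda>i. if i < m then y $ i else 0)"

text \<open>For \<open>n = P * m\<close> and in the same reading, this is the reduction F[X]/(X^n -
  1) -> F[X]/(X^m - 1). The map \<open>pad\<close> picks the representative of degree below
  \<open>m\<close>.\<close>

definition fold_sum :: "nat \<Rightarrow> nat \<Rightarrow> 'a::field vec \<Rightarrow> 'a vec" where
  "fold_sum P m x = vec m (\<lambda>i. \<Sum>t<P. x $ (i + t * m))"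


subsection \<open>Subspaces and linear maps\<close>

lemma vec_subspace_iff:
  fixes U :: "'a::field vec set"
  shows "vec_subspace n U \<longleftrightarrow> U \<subseteq> carrier_vec n \<and> 0\<^sub>v n \<in> U \<and>
    (\<forall>v\<in>U. \<forall>w\<in>U. v + w \<in> U) \<and> (\<forall>c. \<forall>v\<in>U. c \<cdot>\<^sub>v v \<in> U)"
proof -
  have "vectorspace (class_ring :: 'a ring) (module_vec TYPE('a) n)"
    by (rule vec_vs)
  moreover from this have "Module.module (class_ring :: 'a ring) (module_vec TYPE('a) n)"
    by (simp add: vectorspace_def)
  ultimately show ?thesis
    by (auto simp: VectorSpace.subspace_def submodule_def module_vec_simps class_ring_simps)
qed

lemma vec_subspace_minus:
  assumes "vec_subspace n U" "v \<in> U" "w \<in> U"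
  shows "v - w \<in> U"
proof -
  have "v - w = v + (-1) \<cdot>\<^sub>v w"
    using assms by (auto simp: vec_subspace_iff)
  then show ?thesis
    using assms by (auto simp: vec_subspace_iff)
qed

lemma vec_linear_add:
  assumes "vec_linear n m f" "x \<in> carrier_vec n" "y \<in> carrier_vec n"
  shows "f (x + y) = f x + f y"
  using assms by (simp add: vec_linear_def)

lemma vec_linear_zero:
  fixes f :: "'a::field vec \<Rightarrow> 'a vec"
  assumes "vec_linear n m f"
  shows "f (0\<^sub>v n) = 0\<^sub>v m"
proof -
  have c: "f (0\<^sub>v n) \<in> carrier_vec m"
    using assms by (auto simp: vec_linear_def)
  have "0\<^sub>v n = 0 \<cdot>\<^sub>v (0\<^sub>v n :: 'a vec)"
    by (intro eq_vecI) auto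
  then have "f (0\<^sub>v n) = f (0 \<cdot>\<^sub>v 0\<^sub>v n)"
    by (rule arg_cong)
  also have "\<dots> = 0 \<cdot>\<^sub>v f (0\<^sub>v n)"
    using assms by (simp add: vec_linear_def)
  also have "\<dots> = 0\<^sub>v m"
    using c by (intro eq_vecI) auto
  finally show ?thesis .
qed

lemma vec_linear_minus:
  assumes "vec_linear n m f" "x \<in> carrier_vec n" "y \<in> carrier_vec n"
  shows "f (x - y) = f x - f y"
proof -
  have eq: "x - y = x + (-1) \<cdot>\<^sub>v y"
    using assms by auto
  have c: "f x \<in> carrier_vec m" "f y \<in> carrier_vec m"
    using assms by (auto simp: vec_linear_def)
  have "f (x - y) = f x + (-1) \<cdot>\<^sub>v f y"
    unfolding eq using assms by (simp add: vec_linear_def)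
  also have "\<dots> = f x - f y"
    using c by auto
  finally show ?thesis .
qed

lemma vec_linear_funpow:
  assumes "vec_linear n n f"
  shows "vec_linear n n (f ^^ j)"
proof (induction j)
  case (Suc j)
  then show ?case
    using assms by (simp add: vec_linear_def Pi_iff)
qed (auto simp: vec_linear_def)

lemma vec_subspace_preimage:
  assumes f: "vec_linear n m f" and "vec_subspace m U"
  shows "vec_subspace n {x \<in> carrier_vec n. f x \<in> U}"
  using assms vec_linear_zero[OF f] by (auto simp: vec_subspace_iff vec_linear_def)

lemma finite_carrier_vec: "finite (carrier_vec n :: 'a::finite vec set)"
proof (rule finite_subset)
  show "carrier_vec n \<subseteq> vec_of_list ` {xs :: 'a list. set xs \<subseteq> UNIV \<and> length xs = n}"
  proof
    fix x :: "'a vec" assume "x \<in> carrier_vec n"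
    then have "list_of_vec x \<in> {xs. set xs \<subseteq> UNIV \<and> length xs = n}"
      by simp
    then show "x \<in> vec_of_list ` {xs. set xs \<subseteq> UNIV \<and> length xs = n}"
      by (intro image_eqI[where x = "list_of_vec x"]) (simp_all add: vec_list)
  qed
  show "finite (vec_of_list ` {xs :: 'a list. set xs \<subseteq> UNIV \<and> length xs = n})"
    by (intro finite_imageI finite_lists_length_eq) simp
qed

text \<open>A basis of \<open>U\<close> with at least \<open>n\<close> elements stays independent in
  the whole space and therefore spans it. The inequality is the form in which the minimum in
  \<open>cyc_h\<close> delivers the dimension.\<close>

lemma vec_subspace_dim_ge_iff:
  fixes U :: "'a::{finite,field} vec set"
  assumes U: "vec_subspace n U"
  shows "n \<le> subspace_dim n U \<longleftrightarrow> U = carrier_vec n"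
proof
  interpret vec_space "TYPE('a)" n .
  show "U = carrier_vec n" if n: "n \<le> subspace_dim n U"
  proof -
    interpret W: vectorspace "class_ring :: 'a ring" "V\<lparr>carrier := U\<rparr>"
      using U by (rule subspace_is_vs)
    have sub: "U \<subseteq> carrier_vec n"
      using U by (simp add: vec_subspace_iff)
    have finU: "finite U"
      using sub finite_carrier_vec by (rule finite_subset)
    \<comment> \<open>\<open>U\<close> is a finite generating set of itself, which makes a finite
      basis available.\<close>
    have "W.span U = U"
      using W.in_own_span[of U] W.span_is_subset2[of U] by auto
    then have "W.fin_dim"
      unfolding W.fin_dim_def using finU by auto
    then obtain b where b: "finite b" "W.basis b"
      using W.finite_basis_exists by blast
    have bU: "b \<subseteq> U" and li: "\<not> W.lin_dep b" and span: "W.span b = U"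
      using b(2) by (auto simp: W.basis_def)
    \<comment> \<open>This lets span and linear dependence be moved between \<open>U\<close> and the
      ambient space.\<close>
    have sm: "submodule class_ring U V"
      using U by (rule is_module)
    have "card b \<ge> dim"
      using n W.dim_basis[OF b] by (simp add: subspace_dim_def dim_is_n)
    moreover have "lin_indpt b"
      using li span_li_not_depend(2)[OF bU sm] by simp
    ultimately have "basis b"
      using b(1) bU sub by (intro dim_li_is_basis) auto
    then have "span b = carrier_vec n"
      by (simp add: basis_def)
    then show ?thesis
      using span span_li_not_depend(1)[OF bU sm] by simp
  qed
  show "n \<le> subspace_dim n U" if "U = carrier_vec n"
  proof -
    have "V\<lparr>carrier := U\<rparr> = V"
      using that by (simp add: module_vec_def)
    then show ?thesis
      by (simp add: subspace_dim_def dim_is_n)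
  qed
qed


subsection \<open>The cyclic shift\<close>

lemma cyclic_shift_carrier [simp]:
  "cyclic_shift x \<in> carrier_vec n \<longleftrightarrow> x \<in> carrier_vec n"
proof -
  have "dim_vec (cyclic_shift x) = dim_vec x"
    by (simp add: cyclic_shift_def)
  then show ?thesis
    unfolding carrier_vec_def mem_Collect_eq by (rule arg_cong)
qed

lemma cyclic_shift_funpow_carrier [simp]:
  "(cyclic_shift ^^ r) x \<in> carrier_vec n \<longleftrightarrow> x \<in> carrier_vec n"
  by (induction r) auto

lemma cyclic_shift_linear: "vec_linear n n cyclic_shift"
  unfolding vec_linear_def by (auto simp: cyclic_shift_def intro!: eq_vecI)

text \<open>Adding \<open>n - 1\<close> stands for subtracting 1 modulo \<open>n\<close>, so
  iterated shifts compose without truncated subtraction.\<close>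

lemma cyclic_shift_index:
  assumes "x \<in> carrier_vec n" "i < n"
  shows "cyclic_shift x $ i = x $ ((i + (n - 1)) mod n)"
proof (cases "i = 0")
  case False
  then have "i + (n - 1) = (i - 1) + n"
    using assms by simp
  then have "(i + (n - 1)) mod n = (i - 1) mod n"
    by (simp only: mod_add_self2)
  also have "\<dots> = i - 1"
    using assms by simp
  finally have "(i + (n - 1)) mod n = i - 1" .
  with False show ?thesis
    using assms by (auto simp: cyclic_shift_def)
qed (use assms in \<open>auto simp: cyclic_shift_def\<close>)

lemma cyclic_shift_funpow_index_mod:
  assumes "x \<in> carrier_vec n" "i < n"
  shows "(cyclic_shift ^^ r) x $ i = x $ ((i + r * (n - 1)) mod n)"
  using assms(2)
proof (induction r arbitrary: i)
  case (Suc r)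
  have "(cyclic_shift ^^ Suc r) x $ i = (cyclic_shift ^^ r) x $ ((i + (n - 1)) mod n)"
    using assms Suc.prems by (simp add: cyclic_shift_index del: One_nat_def)
  also have "\<dots> = x $ (((i + (n - 1)) mod n + r * (n - 1)) mod n)"
    using Suc by simp
  also have "((i + (n - 1)) mod n + r * (n - 1)) mod n = (i + Suc r * (n - 1)) mod n"
    by (simp add: mod_simps add.assoc)
  finally show ?case .
qed simp

lemma cyclic_shift_funpow_index:
  assumes "x \<in> carrier_vec n" "i < n" "r \<le> n"
  shows "(cyclic_shift ^^ r) x $ i = x $ (if r \<le> i then i - r else i + n - r)"
proof (cases "r \<le> i")
  case True
  then have "i + r * (n - 1) = (i - r) + r * n"
    using assms by (cases n) (auto simp: algebra_simps)
  then have "(i + r * (n - 1)) mod n = (i - r) mod n"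
    by (simp only: mod_mult_self1)
  also have "\<dots> = i - r"
    using assms by simp
  finally have "(i + r * (n - 1)) mod n = i - r" .
  with True show ?thesis
    using assms by (simp add: cyclic_shift_funpow_index_mod del: One_nat_def)
next
  case False
  \<comment> \<open>One of the \<open>r\<close> copies of \<open>n\<close> is kept outside
    \<open>s * n\<close>, so that \<open>i + n - r\<close> does not truncate.\<close>
  then obtain s where s: "r = Suc s"
    by (cases r) auto
  have "i + r * (n - 1) = (i + n - r) + s * n"
    using assms s by (cases n) (auto simp: algebra_simps)
  then have "(i + r * (n - 1)) mod n = (i + n - r) mod n"
    by (simp only: mod_mult_self1)
  also have "\<dots> = i + n - r"
    using assms False by simp
  finally have "(i + r * (n - 1)) mod n = i + n - r" .
  with False show ?thesis
    using assms by (simp add: cyclic_shift_funpow_index_mod del: One_nat_def)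
qed

text \<open>The offset \<open>r * (n - 1)\<close> is a multiple of \<open>n\<close>, so no index
  moves. It follows that every power of the shift is inverted by another power.\<close>

lemma cyclic_shift_funpow_dvd:
  assumes "x \<in> carrier_vec n" "n dvd r"
  shows "(cyclic_shift ^^ r) x = x"
proof (rule eq_vecI)
  have d: "dim_vec ((cyclic_shift ^^ r) x) = n"
    using assms(1) cyclic_shift_funpow_carrier[of r x n] by auto
  then show "dim_vec ((cyclic_shift ^^ r) x) = dim_vec x"
    using assms by auto
  fix i assume "i < dim_vec x"
  then have i: "i < n" using assms by auto
  obtain k where "r = n * k" using assms by auto
  then have "(i + r * (n - 1)) mod n = i"
    using i by (simp add: mult.assoc)
  then show "(cyclic_shift ^^ r) x $ i = x $ i"
    using assms i by (simp add: cyclic_shift_funpow_index_mod)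
qed

text \<open>Shifts are inverted by shifts, so \<open>x\<close> lies in some shifted copy of
  \<open>U\<close> exactly when some shift of \<open>x\<close> lies in \<open>U\<close>.\<close>

lemma cyclically_covering_iff:
  fixes U :: "'a::field vec set"
  assumes "N > 0"
  shows "cyclically_covering N U \<longleftrightarrow> vec_subspace N U \<and> \<not> escapes N U"
proof -
  have "carrier_vec N = (\<Union>i<N. (cyclic_shift ^^ i) ` U) \<longleftrightarrow> \<not> escapes N U"
    if U: "U \<subseteq> carrier_vec N"
  proof
    assume cov: "carrier_vec N = (\<Union>i<N. (cyclic_shift ^^ i) ` U)"
    show "\<not> escapes N U"
      unfolding escapes_def
    proof (rule ccontr, clarsimp)
      fix x :: "'a vec" assume x: "x \<in> carrier_vec N" "\<forall>i. (cyclic_shift ^^ i) x \<notin> U"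
      obtain i u where iu: "i < N" "u \<in> U" "x = (cyclic_shift ^^ i) u"
        using x cov by blast
      then have "(cyclic_shift ^^ (N - i)) x = (cyclic_shift ^^ (N - i + i)) u"
        by (simp only: funpow_add o_apply)
      also have "\<dots> = u"
        using iu U by (intro cyclic_shift_funpow_dvd) auto
      finally show False
        using x iu by metis
    qed
  next
    assume "\<not> escapes N U"
    then have ex: "\<exists>i. (cyclic_shift ^^ i) x \<in> U" if "x \<in> carrier_vec N" for x
      using that by (auto simp: escapes_def)
    show "carrier_vec N = (\<Union>i<N. (cyclic_shift ^^ i) ` U)"
    proof (intro equalityI subsetI)
      fix x :: "'a vec" assume x: "x \<in> carrier_vec N"
      then obtain i where i: "(cyclic_shift ^^ i) x \<in> U"
        using ex by blast
      \<comment> \<open>Modulo \<open>N\<close> the factor \<open>N - 1\<close> is -1, so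
        \<open>j\<close> represents the inverse exponent \<open>-i\<close> within the range of the
        union.\<close>
      define j where "j = (i * (N - 1)) mod N"
      have "N dvd j + i"
      proof -
        have "(j + i) mod N = (i * (N - 1) + i) mod N"
          by (simp add: j_def mod_add_left_eq)
        also have "i * (N - 1) + i = N * i"
          using assms by (cases N) auto
        finally show ?thesis
          by (simp add: mod_eq_0_iff_dvd)
      qed
      then have "(cyclic_shift ^^ (j + i)) x = x"
        using x by (rule cyclic_shift_funpow_dvd[rotated])
      then have "x = (cyclic_shift ^^ j) ((cyclic_shift ^^ i) x)"
        by (simp add: funpow_add)
      moreover have "j < N"
        using assms by (simp add: j_def)
      ultimately show "x \<in> (\<Union>i<N. (cyclic_shift ^^ i) ` U)"
        using i by blast
    qed (use U in auto)
  qed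
  then show ?thesis
    by (auto simp: cyclically_covering_def vec_subspace_iff)
qed

text \<open>On \<open>nat\<close> the difference vanishes exactly when \<open>N\<close> is at most
  the minimum, and only the whole space has dimension at least \<open>N\<close>. So no proper
  subspace may cover, that is, each is escaped.\<close>

lemma cyc_h_eq_0_iff:
  assumes N: "N > 0"
  shows "cyc_h TYPE('a::{finite,field}) N = 0 \<longleftrightarrow>
    (\<forall>U :: 'a vec set. vec_subspace N U \<longrightarrow> U \<noteq> carrier_vec N \<longrightarrow> escapes N U)"
proof -
  let ?D = "{subspace_dim N U | U :: 'a vec set. cyclically_covering N U}"
  have "U \<subseteq> carrier_vec N" if "cyclically_covering N U" for U :: "'a vec set"
    using that by (simp add: cyclically_covering_iff[OF N] vec_subspace_iff)
  then have "?D \<subseteq> subspace_dim N ` Pow (carrier_vec N :: 'a vec set)"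
    by auto
  then have fin: "finite ?D"
    by (rule finite_subset) (simp add: finite_carrier_vec)
  have "cyclically_covering N (carrier_vec N :: 'a vec set)"
    by (auto simp: cyclically_covering_iff[OF N] vec_subspace_iff escapes_def)
  then have ne: "?D \<noteq> {}"
    by blast
  have "cyc_h TYPE('a) N = 0 \<longleftrightarrow> N \<le> Min ?D"
    by (simp add: cyc_h_def)
  also have "\<dots> \<longleftrightarrow> (\<forall>U :: 'a vec set. cyclically_covering N U \<longrightarrow> N \<le> subspace_dim N U)"
    using fin ne by (subst Min_ge_iff) auto
  also have "\<dots> \<longleftrightarrow> (\<forall>U :: 'a vec set. vec_subspace N U \<longrightarrow> U \<noteq> carrier_vec N \<longrightarrow> escapes N U)"
    by (auto simp: cyclically_covering_iff[OF N] vec_subspace_dim_ge_iff)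
  finally show ?thesis .
qed


subsection \<open>Folding onto a divisor\<close>

lemma block_index_less:
  fixes i t m P :: nat
  assumes "i < m" "t < P"
  shows "i + t * m < P * m"
proof -
  have "i + t * m < Suc t * m"
    using assms by simp
  also have "\<dots> \<le> P * m"
    using assms by (intro mult_le_mono1) simp
  finally show ?thesis .
qed

lemma fold_sum_linear: "vec_linear (P * m) m (fold_sum P m)"
  unfolding vec_linear_def
proof (intro conjI ballI allI)
  show "fold_sum P m \<in> carrier_vec (P * m) \<rightarrow> (carrier_vec m :: 'a::field vec set)"
    by (simp add: fold_sum_def)
next
  fix x y :: "'a vec" assume "x \<in> carrier_vec (P * m)" "y \<in> carrier_vec (P * m)"
  then show "fold_sum P m (x + y) = fold_sum P m x + fold_sum P m y"
    by (intro eq_vecI) (auto simp: fold_sum_def block_index_less sum.distrib)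
next
  fix c and x :: "'a vec" assume "x \<in> carrier_vec (P * m)"
  then show "fold_sum P m (c \<cdot>\<^sub>v x) = c \<cdot>\<^sub>v fold_sum P m x"
    by (intro eq_vecI) (auto simp: fold_sum_def block_index_less sum_distrib_left)
qed

text \<open>Shifting moves the residue class of \<open>i - 1\<close> modulo \<open>m\<close> to that
  of \<open>i\<close>, even across the wrap-around, because \<open>m\<close> divides
  \<open>P * m\<close>.\<close>

lemma fold_sum_shift:
  assumes x: "x \<in> carrier_vec (P * m)" and "P > 0"
  shows "fold_sum P m (cyclic_shift x) = cyclic_shift (fold_sum P m x)"
proof (rule eq_vecI)
  show "dim_vec (fold_sum P m (cyclic_shift x)) = dim_vec (cyclic_shift (fold_sum P m x))"
    by (simp add: fold_sum_def cyclic_shift_def)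
  fix i assume "i < dim_vec (cyclic_shift (fold_sum P m x))"
  then have i: "i < m"
    by (simp add: fold_sum_def cyclic_shift_def)
  have shift: "cyclic_shift x $ (i + t * m) =
      (if i + t * m = 0 then x $ (P * m - 1) else x $ (i + t * m - 1))" if "t < P" for t
    using x block_index_less[OF i that] by (simp add: cyclic_shift_def)
  show "fold_sum P m (cyclic_shift x) $ i = cyclic_shift (fold_sum P m x) $ i"
  proof (cases "i = 0")
    case False
    then have "fold_sum P m (cyclic_shift x) $ i = (\<Sum>t<P. x $ (i - 1 + t * m))"
      using i shift by (simp add: fold_sum_def)
    then show ?thesis
      using i False by (simp add: fold_sum_def cyclic_shift_def)
  next
    case True
    obtain Q where Q: "P = Suc Q"
      using \<open>P > 0\<close> by (cases P) auto
    have "fold_sum P m (cyclic_shift x) $ i = (\<Sum>t<Suc Q. cyclic_shift x $ (i + t * m))"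
      using i Q by (simp add: fold_sum_def)
    \<comment> \<open>At \<open>i = 0\<close> the first summand wraps around to the last entry of
      \<open>x\<close>; every later block start receives the last entry of the block before
      it.\<close>
    also have "\<dots> = x $ (P * m - 1) + (\<Sum>t<Q. cyclic_shift x $ (i + Suc t * m))"
      using shift[of 0] True Q by (subst sum.lessThan_Suc_shift) simp
    also have "(\<Sum>t<Q. cyclic_shift x $ (i + Suc t * m)) = (\<Sum>t<Q. x $ (m - 1 + t * m))"
    proof (intro sum.cong refl)
      fix t assume "t \<in> {..<Q}"
      then have "cyclic_shift x $ (i + Suc t * m) = x $ (i + Suc t * m - 1)"
        using shift[of "Suc t"] i Q by simp
      also have "i + Suc t * m - 1 = m - 1 + t * m"
        using True i by simp
      finally show "cyclic_shift x $ (i + Suc t * m) = x $ (m - 1 + t * m)" .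
    qed
    \<comment> \<open>The wrapped entry is the summand \<open>t = Q\<close> missing from the sum
      over \<open>t < Q\<close>.\<close>
    also have "P * m - 1 = m - 1 + Q * m"
      using i Q by simp
    also have "x $ (m - 1 + Q * m) + (\<Sum>t<Q. x $ (m - 1 + t * m)) = (\<Sum>t<P. x $ (m - 1 + t * m))"
      using Q by (simp add: add.commute)
    also have "\<dots> = cyclic_shift (fold_sum P m x) $ i"
      using i True by (simp add: fold_sum_def cyclic_shift_def)
    finally show ?thesis .
  qed
qed

text \<open>Only the block \<open>t = 0\<close> of a padded vector can be nonzero. This makes
  \<open>fold_sum\<close> surjective.\<close>

lemma fold_sum_pad:
  assumes y: "y \<in> carrier_vec m" and "P > 0"
  shows "fold_sum P m (pad (P * m) m y) = y"
proof (rule eq_vecI)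
  show "dim_vec (fold_sum P m (pad (P * m) m y)) = dim_vec y"
    using y by (simp add: fold_sum_def)
  fix i assume "i < dim_vec y"
  then have i: "i < m" using y by simp
  have "fold_sum P m (pad (P * m) m y) $ i = (\<Sum>t<P. if t = 0 then y $ i else 0)"
    unfolding fold_sum_def index_vec[OF i]
  proof (intro sum.cong refl)
    fix t assume "t \<in> {..<P}"
    then have "pad (P * m) m y $ (i + t * m) = (if i + t * m < m then y $ (i + t * m) else 0)"
      using block_index_less[OF i, of t P] by (simp add: pad_def)
    then show "pad (P * m) m y $ (i + t * m) = (if t = 0 then y $ i else 0)"
      using i by (cases t) auto
  qed
  also have "\<dots> = y $ i"
    using \<open>P > 0\<close> by simp
  finally show "fold_sum P m (pad (P * m) m y) $ i = y $ i" .
qed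

text \<open>Pull \<open>U\<close> back along \<open>fold_sum\<close>: surjectivity keeps the
  preimage proper, and equivariance carries a vector escaping the preimage to one escaping
  \<open>U\<close>.\<close>

lemma escapes_fold:
  fixes U :: "'a::field vec set"
  assumes n: "n = P * m" "n > 0"
    and esc: "\<And>U :: 'a vec set. vec_subspace n U \<Longrightarrow> U \<noteq> carrier_vec n \<Longrightarrow> escapes n U"
    and U: "vec_subspace m U" "U \<noteq> carrier_vec m"
  shows "escapes m U"
proof -
  let ?S = "fold_sum P m :: 'a vec \<Rightarrow> 'a vec"
  let ?W = "{x \<in> carrier_vec n. ?S x \<in> U}"
  have P: "P > 0" using n by auto
  obtain y where y: "y \<in> carrier_vec m" "y \<notin> U"
    using U by (auto simp: vec_subspace_iff)
  have "pad n m y \<in> carrier_vec n" "pad n m y \<notin> ?W"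
    using y fold_sum_pad[OF y(1) P] n by (auto simp: pad_def)
  then have "?W \<noteq> carrier_vec n" by blast
  moreover have "vec_subspace n ?W"
    unfolding n(1) using fold_sum_linear U(1) by (rule vec_subspace_preimage)
  ultimately obtain x where x: "x \<in> carrier_vec n" "\<And>i. (cyclic_shift ^^ i) x \<notin> ?W"
    using esc unfolding escapes_def by blast
  have comm: "?S ((cyclic_shift ^^ i) x) = (cyclic_shift ^^ i) (?S x)" for i
    using x P n by (induction i) (auto simp: fold_sum_shift)
  have "(cyclic_shift ^^ i) (?S x) \<notin> U" for i
    using x(1) x(2)[of i] by (simp add: comm)
  moreover have "?S x \<in> carrier_vec m"
    by (simp add: fold_sum_def)
  ultimately show ?thesis
    by (auto simp: escapes_def)
qed


subsection \<open>The difference of a shift power and the identity\<close>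

lemma shift_diff_linear: "vec_linear n n (shift_diff m)"
proof -
  have c: "vec_linear n n (cyclic_shift ^^ m :: 'a::field vec \<Rightarrow> 'a vec)"
    by (rule vec_linear_funpow[OF cyclic_shift_linear])
  show ?thesis
    unfolding vec_linear_def
  proof (intro conjI ballI allI)
    show "shift_diff m \<in> carrier_vec n \<rightarrow> (carrier_vec n :: 'a vec set)"
      by (auto simp: shift_diff_def)
  next
    fix x y :: "'a vec" assume xy: "x \<in> carrier_vec n" "y \<in> carrier_vec n"
    let ?X = "(cyclic_shift ^^ m) x" and ?Y = "(cyclic_shift ^^ m) y"
    have "?X \<in> carrier_vec n" "?Y \<in> carrier_vec n"
      using xy by auto
    then show "shift_diff m (x + y) = shift_diff m x + shift_diff m y"
      using xy c unfolding vec_linear_def shift_diff_def by auto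
  next
    fix c' and x :: "'a vec" assume x: "x \<in> carrier_vec n"
    have "(cyclic_shift ^^ m) x \<in> carrier_vec n"
      using x by auto
    then show "shift_diff m (c' \<cdot>\<^sub>v x) = c' \<cdot>\<^sub>v shift_diff m x"
      using x c unfolding vec_linear_def shift_diff_def
      by (auto simp: algebra_simps)
  qed
qed

lemma shift_diff_carrier: "x \<in> carrier_vec n \<Longrightarrow> shift_diff m x \<in> carrier_vec n"
  by (auto simp: shift_diff_def)

lemma shift_diff_funpow_carrier:
  "x \<in> carrier_vec n \<Longrightarrow> (shift_diff m ^^ j) x \<in> carrier_vec n"
  by (induction j) (auto simp: shift_diff_carrier)

lemma shift_diff_shift:
  assumes "x \<in> carrier_vec n"
  shows "cyclic_shift (shift_diff m x) = shift_diff m (cyclic_shift x)"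
  using assms vec_linear_minus[OF cyclic_shift_linear, of "(cyclic_shift ^^ m) x" n x]
  by (simp add: shift_diff_def funpow_swap1)

lemma shift_diff_funpow_shift:
  assumes "x \<in> carrier_vec n"
  shows "cyclic_shift ((shift_diff m ^^ j) x) = (shift_diff m ^^ j) (cyclic_shift x)"
  using assms by (induction j) (auto simp: shift_diff_shift[where n = n] shift_diff_funpow_carrier)

lemma shift_diff_funpow_shift_funpow:
  assumes "x \<in> carrier_vec n"
  shows "(cyclic_shift ^^ i) ((shift_diff m ^^ j) x) = (shift_diff m ^^ j) ((cyclic_shift ^^ i) x)"
  using assms by (induction i) (auto simp: shift_diff_funpow_shift[where n = n])

text \<open>This is the binomial expansion of the \<open>j\<close>-th power of the operator. The
  binomial coefficients are written as coefficients of (X - 1)^j so that a polynomial identity can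
  be substituted later; the offset \<open>m * (n - 1)\<close> is \<open>-m\<close> modulo
  \<open>n\<close>.\<close>

lemma shift_diff_funpow_index:
  fixes x :: "'a::field vec"
  assumes "x \<in> carrier_vec n" "i < n"
  shows "(shift_diff m ^^ j) x $ i =
    (\<Sum>l\<le>j. coeff ([:-1, 1:] ^ j) l * x $ ((i + l * (m * (n - 1))) mod n))"
  using assms(2)
proof (induction j arbitrary: i)
  case (Suc j)
  let ?q = "[:-1, 1:] ^ j :: 'a poly" and ?s = "m * (n - 1)"
  let ?X = "\<lambda>l. x $ ((i + l * ?s) mod n)"
  have y: "(shift_diff m ^^ j) x \<in> carrier_vec n"
    using assms shift_diff_funpow_carrier by blast
  \<comment> \<open>The degree of \<open>?q\<close> is \<open>j\<close>; this lets both sums below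
    run to \<open>Suc j\<close>.\<close>
  have c: "coeff ?q (Suc j) = 0"
    by (rule coeff_eq_0) (use degree_linear_power[of "-1 :: 'a" j] in simp)
  have "(shift_diff m ^^ Suc j) x $ i =
      (shift_diff m ^^ j) x $ ((i + ?s) mod n) - (shift_diff m ^^ j) x $ i"
    using y Suc.prems by (simp add: shift_diff_def cyclic_shift_funpow_index_mod[OF y] del: One_nat_def)
  also have "\<dots> = (\<Sum>l\<le>j. coeff ?q l * ?X (Suc l)) - (\<Sum>l\<le>j. coeff ?q l * ?X l)"
  proof -
    have "((i + ?s) mod n + l * ?s) mod n = (i + Suc l * ?s) mod n" for l
      by (simp add: mod_simps add.assoc)
    then show ?thesis
      using Suc.IH[of "(i + ?s) mod n"] Suc.IH[of i] Suc.prems by simp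
  qed
  also have "(\<Sum>l\<le>j. coeff ?q l * ?X l) = (\<Sum>l\<le>Suc j. coeff ?q l * ?X l)"
    using c by simp
  \<comment> \<open>\<open>pCons 0 ?q\<close> is X times \<open>?q\<close>, so the difference of the
    two sums belongs to (X - 1) times \<open>?q\<close>.\<close>
  also have "(\<Sum>l\<le>j. coeff ?q l * ?X (Suc l)) = (\<Sum>l\<le>Suc j. coeff (pCons 0 ?q) l * ?X l)"
    by (subst sum.atMost_Suc_shift) simp
  also have "\<dots> - (\<Sum>l\<le>Suc j. coeff ?q l * ?X l) =
      (\<Sum>l\<le>Suc j. coeff ([:-1, 1:] ^ Suc j) l * ?X l)"
    by (simp add: sum_subtractf[symmetric] left_diff_distrib del: sum.atMost_Suc)
  finally show ?case .
qed simp

text \<open>With \<open>(X - 1) ^ p ^ k = X ^ p ^ k - 1\<close> in characteristic \<open>p\<close>, the power \<open>shift_diff m ^^ P\<close>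
  is the \<open>n\<close>-fold shift minus the identity.\<close>

lemma shift_diff_nilpotent:
  fixes x :: "'a::{finite,field} vec"
  assumes P: "P = CHAR('a) ^ k" and n: "n = P * m" and x: "x \<in> carrier_vec n"
  shows "(shift_diff m ^^ P) x = 0\<^sub>v n"
proof (rule eq_vecI)
  have pr: "prime CHAR('a)"
    by (intro prime_CHAR_semidom finite_imp_CHAR_pos) simp
  have P0: "P > 0"
    using pr P by (simp add: prime_gt_0_nat)
  \<comment> \<open>The left base is X = (X - 1) + 1, so additivity of the \<open>P\<close>-th power
    gives X^P = (X - 1)^P + 1.\<close>
  have "([:-1, 1:] + 1 :: 'a poly) ^ P = [:-1, 1:] ^ P + 1 ^ P"
    using pr P by (intro freshmans_dream'[where n = k]) auto
  moreover have "([:-1, 1:] + 1 :: 'a poly) = monom 1 1"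
    by (simp add: one_pCons monom_altdef)
  ultimately have pow: "([:-1, 1:] :: 'a poly) ^ P = monom 1 P - 1"
    by (simp add: monom_power)
  show "dim_vec ((shift_diff m ^^ P) x) = dim_vec (0\<^sub>v n :: 'a vec)"
    using shift_diff_funpow_carrier[OF x] by auto
  fix i assume "i < dim_vec (0\<^sub>v n :: 'a vec)"
  then have i: "i < n" by simp
  let ?X = "\<lambda>l. x $ ((i + l * (m * (n - 1))) mod n)"
  have "(shift_diff m ^^ P) x $ i = (\<Sum>l\<le>P. coeff (monom 1 P - 1) l * ?X l)"
    using shift_diff_funpow_index[OF x i, where m = m and j = P] by (simp only: pow)
  also have "\<dots> = (\<Sum>l\<le>P. (if l = P then ?X l else 0)) - (\<Sum>l\<le>P. if l = 0 then ?X l else 0)"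
    unfolding sum_subtractf[symmetric]
    by (intro sum.cong) (auto simp: left_diff_distrib)
  also have "\<dots> = ?X P - ?X 0"
    by simp
  \<comment> \<open>Since \<open>P * m = n\<close>, the offset is a multiple of
    \<open>n\<close>.\<close>
  also have "?X P = ?X 0"
    using n by (simp add: mult.assoc[symmetric])
  finally show "(shift_diff m ^^ P) x $ i = 0\<^sub>v n $ i"
    using i by simp
qed


subsection \<open>Lifting from the part prime to the characteristic\<close>

lemma pad_carrier: "pad n m y \<in> carrier_vec n"
  by (simp add: pad_def)

lemma pad_linear:
  assumes "m \<le> n"
  shows "vec_linear m n (pad n m)"
  using assms by (auto simp: vec_linear_def pad_def)

lemma shift_diff_index:
  assumes "x \<in> carrier_vec n" "i < n" "m \<le> n"
  shows "shift_diff m x $ i = x $ (if m \<le> i then i - m else i + n - m) - x $ i"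
  using assms cyclic_shift_funpow_index[OF assms] by (simp add: shift_diff_def)

text \<open>The two sides of equivariance differ only in where \<open>y $ (m - 1)\<close> lands:
  index \<open>m\<close> after padding first, index 0 after shifting first. Placing that entry at
  index 0 of \<open>w\<close>, the image of \<open>w\<close> under \<open>shift_diff m\<close>
  corrects this; for \<open>m = n\<close> the positions coincide and the correction is 0.\<close>

lemma pad_shift:
  fixes y :: "'a::field vec"
  assumes y: "y \<in> carrier_vec m" and m: "m > 0" "m \<le> n"
  shows "\<exists>w\<in>carrier_vec n. cyclic_shift (pad n m y) = pad n m (cyclic_shift y) + shift_diff m w"
proof
  define w where "w = vec n (\<lambda>i. if i = 0 then y $ (m - 1) else 0)"
  show w: "w \<in> carrier_vec n"
    by (simp add: w_def)
  have dim: "dim_vec (shift_diff m w) = n"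
    using shift_diff_carrier[OF w] by (rule carrier_vecD)
  show "cyclic_shift (pad n m y) = pad n m (cyclic_shift y) + shift_diff m w"
  proof (rule eq_vecI)
    show "dim_vec (cyclic_shift (pad n m y)) = dim_vec (pad n m (cyclic_shift y) + shift_diff m w)"
      using dim by (simp add: cyclic_shift_def pad_def)
    fix i assume "i < dim_vec (pad n m (cyclic_shift y) + shift_diff m w)"
    then have i: "i < n"
      using dim by simp
    have d: "shift_diff m w $ i = w $ (if m \<le> i then i - m else i + n - m) - w $ i"
      using w i m(2) by (rule shift_diff_index)
    have "(pad n m (cyclic_shift y) + shift_diff m w) $ i =
        pad n m (cyclic_shift y) $ i + shift_diff m w $ i"
      using dim i by (intro index_add_vec) simp
    then show "cyclic_shift (pad n m y) $ i = (pad n m (cyclic_shift y) + shift_diff m w) $ i"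
      unfolding d using i m y
      by (cases "i = 0"; cases "i < m"; cases "i = m"; cases "m = n")
        (auto simp: w_def cyclic_shift_def pad_def)
  qed
qed

text \<open>The shift commutes with \<open>shift_diff m\<close>, so the errors of single steps
  accumulate inside the image of that operator.\<close>

lemma pad_shift_funpow:
  fixes y :: "'a::field vec"
  assumes y: "y \<in> carrier_vec m" and m: "m > 0" "m \<le> n"
  shows "\<exists>w\<in>carrier_vec n.
    (cyclic_shift ^^ i) (pad n m y) = pad n m ((cyclic_shift ^^ i) y) + shift_diff m w"
proof (induction i)
  case 0
  have "shift_diff m (0\<^sub>v n) = (0\<^sub>v n :: 'a vec)"
    by (rule vec_linear_zero[OF shift_diff_linear])
  then show ?case
    using pad_carrier[of n m y] by (intro bexI[of _ "0\<^sub>v n"]) auto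
next
  case (Suc i)
  let ?y = "(cyclic_shift ^^ i) y"
  obtain w where w: "w \<in> carrier_vec n"
    "(cyclic_shift ^^ i) (pad n m y) = pad n m ?y + shift_diff m w"
    using Suc by blast
  obtain v where v: "v \<in> carrier_vec n"
    "cyclic_shift (pad n m ?y) = pad n m (cyclic_shift ?y) + shift_diff m v"
    using pad_shift[of ?y m n] y m by auto
  have sw: "cyclic_shift w \<in> carrier_vec n"
    using w by simp
  have "(cyclic_shift ^^ Suc i) (pad n m y) =
      cyclic_shift (pad n m ?y) + cyclic_shift (shift_diff m w)"
    using vec_linear_add[OF cyclic_shift_linear pad_carrier shift_diff_carrier[OF w(1)]] w(2)
    by simp
  also have "\<dots> = pad n m (cyclic_shift ?y) + shift_diff m v + shift_diff m (cyclic_shift w)"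
    using w v by (simp add: shift_diff_shift)
  also have "\<dots> = pad n m (cyclic_shift ?y) + (shift_diff m v + shift_diff m (cyclic_shift w))"
    by (rule assoc_add_vec[OF pad_carrier shift_diff_carrier[OF v(1)] shift_diff_carrier[OF sw]])
  also have "shift_diff m v + shift_diff m (cyclic_shift w) = shift_diff m (v + cyclic_shift w)"
    using vec_linear_add[OF shift_diff_linear v(1) sw] by simp
  finally have "(cyclic_shift ^^ Suc i) (pad n m y) =
      pad n m ((cyclic_shift ^^ Suc i) y) + shift_diff m (v + cyclic_shift w)"
    by simp
  moreover have "v + cyclic_shift w \<in> carrier_vec n"
    using v sw by simp
  ultimately show ?case
    by blast
qed

text \<open>Peel off blocks of length \<open>m\<close>: a vector is its padded first block plus the
  \<open>m\<close>-fold shift of the rest, and that shift agrees with the rest modulo the image of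
  \<open>shift_diff m\<close>. The induction is on the number \<open>t\<close> of leading blocks
  that may be nonzero.\<close>

lemma subspace_full_if_pad:
  fixes W :: "'a::field vec set"
  assumes n: "n = P * m" "m \<le> n"
    and W: "vec_subspace n W"
    and diff: "\<And>x. x \<in> carrier_vec n \<Longrightarrow> shift_diff m x \<in> W"
    and pad: "\<And>y. y \<in> carrier_vec m \<Longrightarrow> pad n m y \<in> W"
  shows "W = carrier_vec n"
proof -
  have add: "v + w \<in> W" if "v \<in> W" "w \<in> W" for v w
    using that W by (simp add: vec_subspace_iff)
  have "x \<in> W" if "x \<in> carrier_vec n" "\<And>i. t * m \<le> i \<Longrightarrow> i < n \<Longrightarrow> x $ i = 0" for t x
    using that
  proof (induction t arbitrary: x)
    case 0
    then have "x = 0\<^sub>v n"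
      by (intro eq_vecI) auto
    then show ?case
      using W by (simp add: vec_subspace_iff)
  next
    case (Suc t)
    define y where "y = vec m (\<lambda>i. x $ i)"
    define z where "z = vec n (\<lambda>i. if i + m < n then x $ (i + m) else 0)"
    have z: "z \<in> carrier_vec n"
      by (simp add: z_def)
    have "z \<in> W"
    proof (rule Suc.IH[OF z])
      fix i assume "t * m \<le> i" "i < n"
      then show "z $ i = 0"
        using Suc.prems(2)[of "i + m"] by (simp add: z_def)
    qed
    \<comment> \<open>The bracket is the \<open>m\<close>-fold shift of \<open>z\<close>. The last
      \<open>m\<close> entries of \<open>z\<close> are 0, so nothing wraps into the first
      block.\<close>
    have "x = pad n m y + (shift_diff m z + z)"
    proof (rule eq_vecI)
      show "dim_vec x = dim_vec (pad n m y + (shift_diff m z + z))"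
        using Suc.prems(1) z by simp
      fix i assume "i < dim_vec (pad n m y + (shift_diff m z + z))"
      then have i: "i < n" using z by simp
      have d: "shift_diff m z $ i = z $ (if m \<le> i then i - m else i + n - m) - z $ i"
        using z i n(2) by (rule shift_diff_index)
      show "x $ i = (pad n m y + (shift_diff m z + z)) $ i"
        using i z shift_diff_carrier[OF z, of m] d n(2)
        by (cases "m \<le> i") (simp_all add: pad_def y_def z_def)
    qed
    moreover have "y \<in> carrier_vec m"
      by (simp add: y_def)
    ultimately show ?case
      using add pad diff[OF z] \<open>z \<in> W\<close> by simp
  qed
  \<comment> \<open>For \<open>t = P\<close> the vanishing condition is vacuous, since
    \<open>P * m = n\<close>.\<close>
  from this[of _ P] have "carrier_vec n \<subseteq> W"
    using n(1) by auto
  then show ?thesis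
    using W by (auto simp: vec_subspace_iff)
qed

text \<open>Padding is equivariant only modulo the image of \<open>?D\<close>. Replacing
  \<open>U\<close> by a proper \<open>W j\<close> that contains this image makes the error
  harmless.\<close>

lemma escapes_lift:
  fixes U :: "'a::{finite,field} vec set"
  assumes P: "P = CHAR('a) ^ k" and n: "n = P * m" "n > 0"
    and esc: "\<And>U :: 'a vec set. vec_subspace m U \<Longrightarrow> U \<noteq> carrier_vec m \<Longrightarrow> escapes m U"
    and U: "vec_subspace n U" "U \<noteq> carrier_vec n"
  shows "escapes n U"
proof -
  let ?D = "shift_diff m :: 'a vec \<Rightarrow> 'a vec"
  define W where "W j = {x \<in> carrier_vec n. (?D ^^ j) x \<in> U}" for j
  have m: "m > 0" "m \<le> n" using n by auto
  have W: "vec_subspace n (W j)" for j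
    unfolding W_def by (rule vec_subspace_preimage[OF vec_linear_funpow[OF shift_diff_linear] U(1)])
  have "W P = carrier_vec n"
    using U(1) by (auto simp: W_def shift_diff_nilpotent[OF P n(1)] vec_subspace_iff)
  moreover have "W 0 \<noteq> carrier_vec n"
    using U by (auto simp: W_def vec_subspace_iff)
  \<comment> \<open>If fullness always passed from \<open>W (Suc j)\<close> to \<open>W j\<close>,
    it would descend from \<open>P\<close> to 0, where \<open>W 0\<close> is
    \<open>U\<close>.\<close>
  ultimately obtain j where j: "W j \<noteq> carrier_vec n" "W (Suc j) = carrier_vec n"
    using inc_induct[of 0 P "\<lambda>j. W j = carrier_vec n"] by blast
  have diff: "?D x \<in> W j" if "x \<in> carrier_vec n" for x
    using that j(2) by (auto simp: W_def funpow_swap1 shift_diff_carrier)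
  let ?U = "{y \<in> carrier_vec m. pad n m y \<in> W j}"
  have "?U \<noteq> carrier_vec m"
    using subspace_full_if_pad[OF n(1) m(2) W diff] j(1) by blast
  moreover have "vec_subspace m ?U"
    by (rule vec_subspace_preimage[OF pad_linear[OF m(2)] W])
  ultimately obtain y where y: "y \<in> carrier_vec m" "\<And>i. (cyclic_shift ^^ i) y \<notin> ?U"
    using esc unfolding escapes_def by blast
  \<comment> \<open>The error term \<open>?D w\<close> lies in \<open>W j\<close>; subtracting it
    would put a padded shift of \<open>y\<close> into \<open>W j\<close>, although the orbit of
    \<open>y\<close> escapes \<open>?U\<close>.\<close>
  have notin: "(cyclic_shift ^^ i) (pad n m y) \<notin> W j" for i
  proof
    assume *: "(cyclic_shift ^^ i) (pad n m y) \<in> W j"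
    let ?z = "pad n m ((cyclic_shift ^^ i) y)"
    obtain w where w: "w \<in> carrier_vec n" "(cyclic_shift ^^ i) (pad n m y) = ?z + ?D w"
      using pad_shift_funpow[OF y(1) m] by blast
    have "?z \<in> carrier_vec n" "?D w \<in> carrier_vec n"
      using w by (auto simp: pad_def shift_diff_carrier)
    then have "?z = (?z + ?D w) - ?D w"
      by auto
    then have "?z \<in> W j"
      using vec_subspace_minus[OF W * diff[OF w(1)]] w(2) by simp
    then show False
      using y by auto
  qed
  have p: "pad n m y \<in> carrier_vec n"
    by (simp add: pad_def)
  \<comment> \<open>Powers of \<open>?D\<close> commute with shifts, so avoiding \<open>W j\<close>
    turns into avoiding \<open>U\<close> after applying \<open>?D ^^ j\<close>.\<close>
  have "(cyclic_shift ^^ i) ((?D ^^ j) (pad n m y)) \<notin> U" for i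
    using notin[of i] p by (simp add: W_def shift_diff_funpow_shift_funpow)
  then show ?thesis
    using shift_diff_funpow_carrier[OF p] by (auto simp: escapes_def)
qed

theorem theorem1p2:
  fixes p n k m :: nat
  assumes "p = CHAR('a::{finite,field})"
    and "n > 0"
    and "n = p ^ k * m"
    and "coprime m p"
  shows "cyc_h TYPE('a) n = 0 \<longleftrightarrow> cyc_h TYPE('a) m = 0"
proof -
  have m: "m > 0" using assms by auto
  show ?thesis
    unfolding cyc_h_eq_0_iff[OF assms(2)] cyc_h_eq_0_iff[OF m]
    using escapes_fold[OF assms(3,2), where ?'a = 'a]
      escapes_lift[where P = "p ^ k" and n = n and m = m and ?'a = 'a, OF _ assms(3,2)] assms(1)
    by blast
qed

end
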